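(* Let $\mathcal{A}$ be an irreducible module over the associative algebra $\mathcal{K}=\mathbb{C}[t,t^{-1},\partial]$. For any $\alpha,\beta\in\mathbb{C}$, the formulas $$L_m v=\big(t^{m}\partial+m\alpha t^m\big)v,\qquad I_m v=\beta t^m v,\qquad C_i v=0\qquad (m\in\mathbb{Z},\ i\in\{1,2,3\},\ v\in\mathcal{A})$$ define on $\mathcal{A}$ the structure of a module over the twisted Heisenberg-Virasoro algebra $\mathcal{H}$ (this module is denoted $\mathcal{A}_{\alpha,\beta}$).
   Context: All vector spaces are over $\mathbb{C}$. The twisted Heisenberg-Virasoro algebra $\mathcal{H}$ is the complex Lie algebra with basis $\{L_m,I_m,C_1,C_2,C_3\mid m\in\mathbb{Z}\}$ and brackets $$[L_m,L_n]=(n-m)L_{m+n}+\delta_{m+n,0}\tfrac{m^3-m}{12}C_1,\quad [L_m,I_n]=nI_{m+n}+\delta_{m+n,0}(m^2+m)C_2,\quad [I_m,I_n]=n\delta_{m+n,0}C_3,$$ with $C_1,C_2,C_3$ central. $\mathcal{K}=\mathbb{C}[t,t^{-1},\partial]$ is the associative algebra of Laurent polynomial differential operators, where $\partial=t\frac{d}{dt}$, so that $\partial t^n=t^n(\partial+n)$ for $n\in\mathbb{Z}$. *)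

theory Defs
  imports Complex_Main "HOL-Library.Poly_Mapping"
begin

section \<open>Lie algebras, associative algebras and their modules\<close>

locale lie_algebra = vector_space scale
  for scale :: "'k::field \<Rightarrow> 'g::ab_group_add \<Rightarrow> 'g" +
  fixes bracket :: "'g \<Rightarrow> 'g \<Rightarrow> 'g"
  assumes bracket_add_left: "bracket (x + y) z = bracket x z + bracket y z"
    and bracket_add_right: "bracket x (y + z) = bracket x y + bracket x z"
    and bracket_scale_left: "bracket (scale c x) y = scale c (bracket x y)"
    and bracket_scale_right: "bracket x (scale c y) = scale c (bracket x y)"
    and bracket_self: "bracket x x = 0"
    and jacobi: "bracket x (bracket y z) + bracket y (bracket z x) + bracket z (bracket x y) = 0"

locale lie_module =
  G: lie_algebra scaleG bracket + V: vector_space scaleV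
  for scaleG :: "'k::field \<Rightarrow> 'g::ab_group_add \<Rightarrow> 'g"
    and bracket :: "'g \<Rightarrow> 'g \<Rightarrow> 'g"
    and scaleV :: "'k \<Rightarrow> 'v::ab_group_add \<Rightarrow> 'v" +
  fixes act :: "'g \<Rightarrow> 'v \<Rightarrow> 'v"
  assumes act_add_left: "act (x + y) v = act x v + act y v"
    and act_add_right: "act x (v + w) = act x v + act x w"
    and act_scale_left: "act (scaleG c x) v = scaleV c (act x v)"
    and act_scale_right: "act x (scaleV c v) = scaleV c (act x v)"
    and act_bracket: "act (bracket x y) v = act x (act y v) - act y (act x v)"

locale assoc_algebra = vector_space scale
  for scale :: "'k::field \<Rightarrow> 'a::ring_1 \<Rightarrow> 'a" +
  assumes scale_mult_left: "scale c x * y = scale c (x * y)"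
    and scale_mult_right: "x * scale c y = scale c (x * y)"

locale assoc_module =
  A: assoc_algebra scaleA + V: vector_space scaleV
  for scaleA :: "'k::field \<Rightarrow> 'a::ring_1 \<Rightarrow> 'a"
    and scaleV :: "'k \<Rightarrow> 'v::ab_group_add \<Rightarrow> 'v" +
  fixes act :: "'a \<Rightarrow> 'v \<Rightarrow> 'v"
  assumes act_add_left: "act (x + y) v = act x v + act y v"
    and act_add_right: "act x (v + w) = act x v + act x w"
    and act_scale_left: "act (scaleA c x) v = scaleV c (act x v)"
    and act_scale_right: "act x (scaleV c v) = scaleV c (act x v)"
    and act_mult: "act (x * y) v = act x (act y v)"
    and act_one: "act 1 v = v"
begin

definition submodule :: "'v set \<Rightarrow> bool"
  where "submodule W \<longleftrightarrow> V.subspace W \<and> (\<forall>x. \<forall>w\<in>W. act x w \<in> W)"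

end

locale irreducible_assoc_module = assoc_module scaleA scaleV act
  for scaleA :: "'k::field \<Rightarrow> 'a::ring_1 \<Rightarrow> 'a"
    and scaleV :: "'k \<Rightarrow> 'v::ab_group_add \<Rightarrow> 'v"
    and act :: "'a \<Rightarrow> 'v \<Rightarrow> 'v" +
  assumes nonzero: "\<exists>v::'v. v \<noteq> 0"
    and irreducible: "submodule W \<Longrightarrow> W = {0} \<or> W = UNIV"


section \<open>The algebra of Laurent polynomial differential operators\<close>

text \<open>A finitely supported family \<^term>\<open>f\<close> of coefficients stands for the Laurent polynomial
  whose coefficient of \<open>t\<^sup>k\<close> is \<^term>\<open>Poly_Mapping.lookup f k\<close>; the product of the library is
  the usual (convolution) product.\<close>

type_synonym laurent = "int \<Rightarrow>\<^sub>0 complex"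

text \<open>The Euler operator \<open>t d/dt\<close> multiplies \<open>t\<^sup>k\<close> by \<open>k\<close>.\<close>

definition euler :: "laurent \<Rightarrow> laurent"
  where "euler f = Poly_Mapping.mapp (\<lambda>k c. of_int k * c) f"

text \<open>The algebra of operators on Laurent polynomials generated by the multiplication operators
  and the Euler operator. Scalar multiples and negatives of an operator arise by composition
  with multiplication by a constant.\<close>

inductive_set diff_ops :: "(laurent \<Rightarrow> laurent) set" where
  mult: "(\<lambda>f. p * f) \<in> diff_ops"
| euler: "euler \<in> diff_ops"
| add: "D \<in> diff_ops \<Longrightarrow> E \<in> diff_ops \<Longrightarrow> (\<lambda>f. D f + E f) \<in> diff_ops"
| comp: "D \<in> diff_ops \<Longrightarrow> E \<in> diff_ops \<Longrightarrow> (\<lambda>f. D (E f)) \<in> diff_ops"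

typedef lpdo = diff_ops
  morphisms apply_op Abs_lpdo
  using diff_ops.mult by blast

lemma lookup_euler: "Poly_Mapping.lookup (euler f) k = of_int k * Poly_Mapping.lookup f k"
  by (simp add: euler_def lookup_mapp when_def in_keys_iff)

lemma euler_add: "euler (f + g) = euler f + euler g"
  by (rule poly_mapping_eqI) (simp add: lookup_euler lookup_add algebra_simps)

lemma lookup_const_mult:
  "Poly_Mapping.lookup (Poly_Mapping.single 0 c * (f :: 'a::monoid_add \<Rightarrow>\<^sub>0 'b::semiring_0)) k
     = c * Poly_Mapping.lookup f k"
  by (simp flip: mult_map_scale_conv_mult add: map.rep_eq when_def)

lemma euler_const_mult: "euler (Poly_Mapping.single 0 c * f) = Poly_Mapping.single 0 c * euler f"
  by (rule poly_mapping_eqI) (simp add: lookup_euler lookup_const_mult)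

lemma diff_ops_add: "D \<in> diff_ops \<Longrightarrow> D (f + g) = D f + D g"
  by (induction arbitrary: f g rule: diff_ops.induct) (simp_all add: algebra_simps euler_add)

lemma diff_ops_const_mult:
  "D \<in> diff_ops \<Longrightarrow> D (Poly_Mapping.single 0 c * f) = Poly_Mapping.single 0 c * D f"
  by (induction arbitrary: f rule: diff_ops.induct) (simp_all add: mult.left_commute distrib_left euler_const_mult)

lemma diff_ops_const: "D \<in> diff_ops \<Longrightarrow> (\<lambda>f. Poly_Mapping.single 0 c * D f) \<in> diff_ops"
  by (rule diff_ops.comp[OF diff_ops.mult])

lemma diff_ops_uminus: "D \<in> diff_ops \<Longrightarrow> (\<lambda>f. - D f) \<in> diff_ops"
  using diff_ops_const[of D "-1"] by (simp add: single_uminus)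

setup_lifting type_definition_lpdo

instantiation lpdo :: ring_1
begin

lift_definition zero_lpdo :: lpdo is "\<lambda>f. 0"
proof -
  have "(*) 0 = (\<lambda>f :: laurent. 0 :: laurent)" by (rule ext) simp
  then show "(\<lambda>f. 0) \<in> diff_ops" using diff_ops.mult[of 0] by simp
qed

lift_definition one_lpdo :: lpdo is "\<lambda>f. f"
proof -
  have "(*) 1 = (\<lambda>f :: laurent. f)" by (rule ext) simp
  then show "(\<lambda>f. f) \<in> diff_ops" using diff_ops.mult[of 1] by simp
qed

lift_definition plus_lpdo :: "lpdo \<Rightarrow> lpdo \<Rightarrow> lpdo" is "\<lambda>D E f. D f + E f"
  by (rule diff_ops.add)

lift_definition uminus_lpdo :: "lpdo \<Rightarrow> lpdo" is "\<lambda>D f. - D f"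
  by (rule diff_ops_uminus)

lift_definition minus_lpdo :: "lpdo \<Rightarrow> lpdo \<Rightarrow> lpdo" is "\<lambda>D E f. D f - E f"
  using diff_ops.add diff_ops_uminus by fastforce

lift_definition times_lpdo :: "lpdo \<Rightarrow> lpdo \<Rightarrow> lpdo" is "\<lambda>D E f. D (E f)"
  by (rule diff_ops.comp)

instance
proof
  show "(0::lpdo) \<noteq> 1"
    by transfer (metis zero_neq_one)
qed (transfer; simp add: algebra_simps diff_ops_add fun_eq_iff)+

end

lift_definition lpdo_scale :: "complex \<Rightarrow> lpdo \<Rightarrow> lpdo" is "\<lambda>c D f. Poly_Mapping.single 0 c * D f"
  by (rule diff_ops_const)

lift_definition t_pow :: "int \<Rightarrow> lpdo" is "\<lambda>n f. Poly_Mapping.single n 1 * f"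
  by (rule diff_ops.mult)

lift_definition del :: lpdo is euler
  by (rule diff_ops.euler)

interpretation lpdo: assoc_algebra lpdo_scale
proof
  fix a b :: complex and x y :: lpdo
  show "lpdo_scale a (x + y) = lpdo_scale a x + lpdo_scale a y"
    by transfer (simp add: algebra_simps)
  show "lpdo_scale (a + b) x = lpdo_scale a x + lpdo_scale b x"
    by transfer (simp add: single_add algebra_simps)
  show "lpdo_scale a (lpdo_scale b x) = lpdo_scale (a * b) x"
    by transfer (simp add: mult_single flip: mult.assoc)
  show "lpdo_scale 1 x = x"
    by transfer simp
  show "lpdo_scale a x * y = lpdo_scale a (x * y)"
    by transfer simp
  show "x * lpdo_scale a y = lpdo_scale a (x * y)"
    by transfer (simp add: diff_ops_const_mult)
qed

lemma t_pow_zero: "t_pow 0 = 1"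
  by transfer simp

lemma t_pow_add: "t_pow (m + n) = t_pow m * t_pow n"
  by transfer (simp add: mult_single flip: mult.assoc)

lemma lookup_monom_mult:
  "Poly_Mapping.lookup (Poly_Mapping.single n 1 * (f :: laurent)) k = Poly_Mapping.lookup f (k - n)"
proof -
  have *: "(k = a + q) = (q = k - a)" for a q :: int by auto
  show ?thesis
    by (simp add: lookup_mult lookup_single * when_mult)
qed

lemma del_t_pow: "del * t_pow n = t_pow n * (del + lpdo_scale (of_int n) 1)"
proof transfer
  fix n :: int
  show "(\<lambda>f. euler (Poly_Mapping.single n 1 * f))
      = (\<lambda>f. Poly_Mapping.single n 1 * (euler f + Poly_Mapping.single 0 (of_int n) * f))"
    by (intro ext poly_mapping_eqI)
      (simp only: lookup_euler lookup_monom_mult lookup_const_mult lookup_add distrib_left,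
        simp add: algebra_simps)
qed


section \<open>The twisted Heisenberg-Virasoro algebra\<close>

datatype hv_basis = BL int | BI int | BC1 | BC2 | BC3

type_synonym hv = "hv_basis \<Rightarrow>\<^sub>0 complex"

definition hv_scale :: "complex \<Rightarrow> hv \<Rightarrow> hv"
  where "hv_scale c x = Poly_Mapping.map ((*) c) x"

definition hvL :: "int \<Rightarrow> hv" where "hvL m = Poly_Mapping.single (BL m) 1"
definition hvI :: "int \<Rightarrow> hv" where "hvI m = Poly_Mapping.single (BI m) 1"
definition hvC1 :: hv where "hvC1 = Poly_Mapping.single BC1 1"
definition hvC2 :: hv where "hvC2 = Poly_Mapping.single BC2 1"
definition hvC3 :: hv where "hvC3 = Poly_Mapping.single BC3 1"

text \<open>The brackets \<open>[I\<^sub>n, L\<^sub>m]\<close> are determined by antisymmetry from \<open>[L\<^sub>m, I\<^sub>n]\<close>;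
  \<open>hv_bracket\<close> is the bilinear extension.\<close>

fun bracket_basis :: "hv_basis \<Rightarrow> hv_basis \<Rightarrow> hv" where
  "bracket_basis (BL m) (BL n) = hv_scale (of_int (n - m)) (hvL (m + n))
     + (if m + n = 0 then hv_scale (of_int (m ^ 3 - m) / 12) hvC1 else 0)"
| "bracket_basis (BL m) (BI n) = hv_scale (of_int n) (hvI (m + n))
     + (if m + n = 0 then hv_scale (of_int (m\<^sup>2 + m)) hvC2 else 0)"
| "bracket_basis (BI n) (BL m) = - (hv_scale (of_int n) (hvI (m + n))
     + (if m + n = 0 then hv_scale (of_int (m\<^sup>2 + m)) hvC2 else 0))"
| "bracket_basis (BI m) (BI n) = (if m + n = 0 then hv_scale (of_int n) hvC3 else 0)"
| "bracket_basis _ _ = 0"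

definition hv_bracket :: "hv \<Rightarrow> hv \<Rightarrow> hv"
  where "hv_bracket x y = (\<Sum>a\<in>Poly_Mapping.keys x. \<Sum>b\<in>Poly_Mapping.keys y.
    hv_scale (Poly_Mapping.lookup x a * Poly_Mapping.lookup y b) (bracket_basis a b))"

lemma lookup_hv_scale [simp]:
  "Poly_Mapping.lookup (hv_scale c x) k = c * Poly_Mapping.lookup x k"
  by (simp add: hv_scale_def map.rep_eq when_def)

interpretation hv: vector_space hv_scale
  by unfold_locales (auto intro!: poly_mapping_eqI simp: lookup_add algebra_simps)

lemma hv_bracket_add_left: "hv_bracket (x + y) z = hv_bracket x z + hv_bracket y z"
  unfolding hv_bracket_def
  by (rule setsum_keys_plus_distrib)
    (simp_all add: hv.scale_left_distrib distrib_right sum.distrib)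

lemma hv_bracket_add_right: "hv_bracket x (y + z) = hv_bracket x y + hv_bracket x z"
  unfolding hv_bracket_def sum.distrib[symmetric]
  by (rule sum.cong[OF refl], rule setsum_keys_plus_distrib)
    (simp_all add: hv.scale_left_distrib distrib_left)

lemma hv_keys_scale: "c \<noteq> 0 \<Longrightarrow> Poly_Mapping.keys (hv_scale c x) = Poly_Mapping.keys x"
  by (auto simp: in_keys_iff)

lemma hv_bracket_scale_left: "hv_bracket (hv_scale c x) y = hv_scale c (hv_bracket x y)"
  by (cases "c = 0")
    (simp_all add: hv_bracket_def hv_keys_scale hv.scale_sum_right mult.assoc)

lemma hv_bracket_scale_right: "hv_bracket x (hv_scale c y) = hv_scale c (hv_bracket x y)"
  by (cases "c = 0")
    (simp_all add: hv_bracket_def hv_keys_scale hv.scale_sum_right mult.left_commute)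

lemma hv_bracket_single:
  "hv_bracket (Poly_Mapping.single a 1) (Poly_Mapping.single b 1) = bracket_basis a b"
  by (simp add: hv_bracket_def)

lemma hv_single: "Poly_Mapping.single a c = hv_scale c (Poly_Mapping.single a 1)"
  by (rule poly_mapping_eqI) (simp add: lookup_single when_def)

lemma hv_induct [case_names basis scale add]:
  assumes basis: "\<And>a. P (Poly_Mapping.single a 1)"
    and scale: "\<And>c x. P x \<Longrightarrow> P (hv_scale c x)"
    and add: "\<And>x y. P x \<Longrightarrow> P y \<Longrightarrow> P (x + y)"
  shows "P x"
proof (induction x rule: update_induct)
  case const
  show ?case using scale[OF basis, of 0] by simp
next
  case (update x a c)
  then have "Poly_Mapping.update a c x = x + hv_scale c (Poly_Mapping.single a 1)"
    by (intro poly_mapping_eqI)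
      (auto simp: lookup_update lookup_add lookup_single when_def in_keys_iff)
  then show ?case using add[OF update.IH scale[OF basis]] by simp
qed

lemma hv_bracket_zero [simp]: "hv_bracket 0 x = 0" "hv_bracket x 0 = 0"
  by (simp_all add: hv_bracket_def)

lemma hv_bracket_uminus: "hv_bracket (- x) y = - hv_bracket x y" "hv_bracket x (- y) = - hv_bracket x y"
  using hv_bracket_scale_left[of "-1"] hv_bracket_scale_right[of _ "-1"] by simp_all

lemma bracket_basis_swap: "bracket_basis a b = - bracket_basis b a"
  by (cases a; cases b)
    (auto intro!: poly_mapping_eqI
      simp: hvL_def hvI_def hvC1_def hvC3_def lookup_add lookup_single when_def field_simps
        add_eq_0_iff)

lemma hv_bracket_swap: "hv_bracket x y = - hv_bracket y x"
proof (induction x rule: hv_induct)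
  case (basis a)
  show ?case
    by (induction y rule: hv_induct)
      (simp_all add: hv_bracket_single hv_bracket_scale_left hv_bracket_scale_right
        hv_bracket_add_left hv_bracket_add_right bracket_basis_swap[of a])
qed (simp_all add: hv_bracket_scale_left hv_bracket_scale_right
        hv_bracket_add_left hv_bracket_add_right)

lemma hv_bracket_self: "hv_bracket x x = 0"
proof (rule poly_mapping_eqI)
  fix k
  have "Poly_Mapping.lookup (hv_bracket x x) k = - Poly_Mapping.lookup (hv_bracket x x) k"
    by (metis hv_bracket_swap lookup_uminus)
  then show "Poly_Mapping.lookup (hv_bracket x x) k = Poly_Mapping.lookup 0 k" by simp
qed

lemma hv_if_scale: "(if P then hv_scale c x else 0) = hv_scale (if P then c else 0) x"
  by simp

lemma hv_bracket_diff: "hv_bracket x (y - z) = hv_bracket x y - hv_bracket x z"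
  using hv_bracket_add_right[of x y "- z"] by (simp add: hv_bracket_uminus)

lemma hv_jacobi_basis:
  fixes a b d :: hv_basis
  defines "x \<equiv> Poly_Mapping.single a 1" and "y \<equiv> Poly_Mapping.single b 1"
    and "z \<equiv> Poly_Mapping.single d 1"
  shows "hv_bracket x (hv_bracket y z) + hv_bracket y (hv_bracket z x)
    + hv_bracket z (hv_bracket x y) = 0"
proof -
  define J where "J a b d =
    hv_bracket (Poly_Mapping.single a 1) (bracket_basis b d)
    + hv_bracket (Poly_Mapping.single b 1) (bracket_basis d a)
    + hv_bracket (Poly_Mapping.single d 1) (bracket_basis a b)" for a b d
  note defs = J_def hv_if_scale hvL_def hvI_def hvC1_def hvC2_def hvC3_def
  note linear = hv_bracket_single hv_bracket_add_right hv_bracket_scale_right hv_bracket_uminus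
    hv_bracket_diff
  note coeff = lookup_add lookup_minus lookup_single when_def
  have rot: "J a b d = J b d a" for a b d
    by (simp add: J_def algebra_simps)
  have LLL: "J (BL m) (BL n) (BL p) = 0" for m n p
  proof (rule poly_mapping_eqI, cases "p = - m - n")
    case True
    show "Poly_Mapping.lookup (J (BL m) (BL n) (BL p)) k = Poly_Mapping.lookup 0 k" for k
      unfolding True by (simp add: defs linear coeff algebra_simps power3_eq_cube add_divide_distrib diff_divide_distrib)
  next
    case False
    then show "Poly_Mapping.lookup (J (BL m) (BL n) (BL p)) k = Poly_Mapping.lookup 0 k" for k
      by (auto simp: defs linear coeff algebra_simps)
  qed
  have LLI: "J (BL m) (BL n) (BI p) = 0" for m n p
  proof (rule poly_mapping_eqI, cases "p = - m - n")
    case True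
    show "Poly_Mapping.lookup (J (BL m) (BL n) (BI p)) k = Poly_Mapping.lookup 0 k" for k
      unfolding True by (simp add: defs linear coeff algebra_simps power2_eq_square)
  next
    case False
    then show "Poly_Mapping.lookup (J (BL m) (BL n) (BI p)) k = Poly_Mapping.lookup 0 k" for k
      by (auto simp: defs linear coeff algebra_simps)
  qed
  have LII: "J (BL m) (BI n) (BI p) = 0" for m n p
  proof (rule poly_mapping_eqI, cases "p = - m - n")
    case True
    show "Poly_Mapping.lookup (J (BL m) (BI n) (BI p)) k = Poly_Mapping.lookup 0 k" for k
      unfolding True by (simp add: defs linear coeff algebra_simps)
  next
    case False
    then show "Poly_Mapping.lookup (J (BL m) (BI n) (BI p)) k = Poly_Mapping.lookup 0 k" for k
      by (auto simp: defs linear coeff algebra_simps)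
  qed
  have central: "J a b d = 0" if "a \<in> {BC1, BC2, BC3}" for a b d
    using that by (cases b; cases d) (auto simp: defs linear)
  have III: "J (BI m) (BI n) (BI p) = 0" for m n p
    by (simp add: defs linear)
  have rotated: "J b d a = 0" "J d a b = 0" if "J a b d = 0" for a b d
    using that rot[of a b d] rot[of b d a] by simp_all
  have "J a b d = 0"
    by (cases a; cases b; cases d)
      (simp_all add: central LLL LLI LII III rotated[OF LLI] rotated[OF LII] rotated[OF central])
  then show ?thesis
    by (simp add: x_def y_def z_def J_def hv_bracket_single)
qed

lemma hv_jacobi: "hv_bracket x (hv_bracket y z) + hv_bracket y (hv_bracket z x)
    + hv_bracket z (hv_bracket x y) = 0"
proof -
  define J where "J x y z = hv_bracket x (hv_bracket y z) + hv_bracket y (hv_bracket z x)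
    + hv_bracket z (hv_bracket x y)" for x y z
  note linear = hv_bracket_scale_left hv_bracket_scale_right hv_bracket_add_left
    hv_bracket_add_right
  have scale: "J (hv_scale c x) y z = hv_scale c (J x y z)" for c x y z
    by (simp add: J_def linear hv.scale_right_distrib)
  have add: "J (x + w) y z = J x y z + J w y z" for x w y z
    by (simp add: J_def linear algebra_simps)
  have rot: "J x y z = J y z x" for x y z
    by (simp add: J_def algebra_simps)
  have "J x y z = 0"
  proof (induction x rule: hv_induct)
    case (basis a)
    show ?case
      unfolding rot[of _ y z]
    proof (induction y rule: hv_induct)
      case (basis b)
      show ?case
        unfolding rot[of _ z]
      proof (induction z rule: hv_induct)
        case (basis d)
        show ?case by (simp only: J_def hv_jacobi_basis)
      qed (simp_all add: scale add)
    qed (simp_all add: scale add)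
  qed (simp_all add: scale add)
  then show ?thesis by (simp add: J_def)
qed

interpretation hv: lie_algebra hv_scale hv_bracket
  by unfold_locales
    (simp_all add: hv_bracket_add_left hv_bracket_add_right hv_bracket_scale_left
      hv_bracket_scale_right hv_bracket_self hv_jacobi)

lemma hv_brackets:
  "hv_bracket (hvL m) (hvL n) = hv_scale (of_int (n - m)) (hvL (m + n))
     + (if m + n = 0 then hv_scale (of_int (m ^ 3 - m) / 12) hvC1 else 0)"
  "hv_bracket (hvL m) (hvI n) = hv_scale (of_int n) (hvI (m + n))
     + (if m + n = 0 then hv_scale (of_int (m\<^sup>2 + m)) hvC2 else 0)"
  "hv_bracket (hvI m) (hvI n) = (if m + n = 0 then hv_scale (of_int n) hvC3 else 0)"
  using hv_bracket_single[of "BL m" "BL n"] hv_bracket_single[of "BL m" "BI n"]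
    hv_bracket_single[of "BI m" "BI n"]
  by (simp_all add: hvL_def hvI_def)

lemma hv_central: "hv_bracket hvC1 x = 0" "hv_bracket hvC2 x = 0" "hv_bracket hvC3 x = 0"
  by (induction x rule: hv_induct)
    (simp_all add: hvC1_def hvC2_def hvC3_def hv_bracket_single hv_bracket_scale_right
      hv_bracket_add_right)

end

theory Submission
  imports Defs
begin

text \<open>A module over an associative algebra is a module over its commutator Lie algebra, and it can
  be pulled back along any Lie algebra homomorphism. So everything rests on the linear map from
  the twisted Heisenberg-Virasoro algebra to differential operators that sends
  \<open>L\<^sub>m\<close> to \<open>t\<^sup>m (\<partial> + m \<alpha>)\<close>, \<open>I\<^sub>m\<close> to \<open>\<beta> t\<^sup>m\<close> and the central elements to \<open>0\<close> being a Lie algebra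
  homomorphism (\<open>hv_to_lpdo_bracket\<close>).

  By bilinearity this is a computation on basis elements. Moving \<open>t\<^sup>n\<close> to the left past \<open>\<partial>\<close> replaces
  \<open>\<partial>\<close> by \<open>\<partial> + n\<close>, so \<open>[t\<^sup>m (\<partial> + m \<alpha>), \<beta> t\<^sup>n] = n \<beta> t\<^bsup>m+n\<^esup>\<close>, and the commutator of
  \<open>t\<^sup>m (\<partial> + m \<alpha>)\<close> and \<open>t\<^sup>n (\<partial> + n \<alpha>)\<close> is \<open>t\<^bsup>m+n\<^esup>\<close> times
  \<open>(\<partial> + n + m \<alpha>) (\<partial> + n \<alpha>) - (\<partial> + m + n \<alpha>) (\<partial> + m \<alpha>) = (n - m) (\<partial> + (m + n) \<alpha>)\<close>.
  The operators \<open>\<beta> t\<^sup>m\<close> commute with each other. No cocycle terms appear, which matches the vanishing of the central elements. The action is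
  unique because a linear map is determined by its values on a basis.\<close>

lemma (in assoc_module) lie_module_pullback:
  assumes "lie_algebra scaleG bracket"
    and add: "\<And>x y. \<phi> (x + y) = \<phi> x + \<phi> y"
    and scale: "\<And>c x. \<phi> (scaleG c x) = scaleA c (\<phi> x)"
    and bracket: "\<And>x y. \<phi> (bracket x y) = \<phi> x * \<phi> y - \<phi> y * \<phi> x"
  shows "lie_module scaleG bracket scaleV (\<lambda>x. act (\<phi> x))"
proof -
  interpret G: lie_algebra scaleG bracket by fact
  have diff: "act (x - y) v = act x v - act y v" for x y v
    using act_add_left[of "x - y" y v] by simp
  show ?thesis
    by unfold_locales
      (simp_all add: add scale bracket diff act_add_left act_add_right act_scale_left
        act_scale_right act_mult)
qed

text \<open>\<open>vect m a\<close> is \<open>t\<^sup>m (\<partial> + a)\<close>, multiplied out.\<close>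

definition vect :: "int \<Rightarrow> complex \<Rightarrow> lpdo"
  where "vect m a = t_pow m * del + lpdo_scale a (t_pow m)"

lemma vect_mult_t_pow: "vect m a * t_pow n = vect (m + n) (of_int n + a)"
proof -
  have "t_pow m * del * t_pow n = t_pow m * (t_pow n * (del + lpdo_scale (of_int n) 1))"
    by (simp only: mult.assoc del_t_pow)
  also have "\<dots> = vect (m + n) (of_int n)"
    by (simp add: vect_def t_pow_add lpdo.scale_mult_right distrib_left mult.assoc)
  finally show ?thesis
    by (simp add: vect_def t_pow_add lpdo.scale_mult_left lpdo.scale_left_distrib distrib_right
        add.assoc)
qed

lemma t_pow_mult_vect: "t_pow m * vect n a = vect (m + n) a"
  by (simp add: vect_def t_pow_add lpdo.scale_mult_right distrib_left mult.assoc)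

text \<open>The factor \<open>\<partial> + b\<close> of \<open>vect n b = t\<^sup>n (\<partial> + b)\<close> can be split off on the right and
  the rest multiplied out by \<open>vect_mult_t_pow\<close>. The coefficient of \<open>t\<^bsup>m+n\<^esup> \<partial>\<close>
  exceeds the symmetric expression \<open>a + b\<close> by \<open>n\<close>; this asymmetry produces the commutator.\<close>

lemma vect_mult_vect:
  "vect m a * vect n b = t_pow (m + n) * del * del
     + lpdo_scale (of_int n + a + b) (t_pow (m + n) * del)
     + lpdo_scale ((of_int n + a) * b) (t_pow (m + n))"
proof -
  have "vect m a * vect n b = vect m a * t_pow n * del + lpdo_scale b (vect m a * t_pow n)"
    by (simp add: vect_def[of n] lpdo.scale_mult_right distrib_left mult.assoc)
  also have "\<dots> = vect (m + n) (of_int n + a) * del + lpdo_scale b (vect (m + n) (of_int n + a))"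
    by (simp only: vect_mult_t_pow)
  finally show ?thesis
    by (simp add: vect_def lpdo.scale_mult_left lpdo.scale_left_distrib lpdo.scale_right_distrib
        distrib_right mult.commute[of b] add_ac)
qed

lemma vect_commutator:
  "vect m (of_int m * \<alpha>) * vect n (of_int n * \<alpha>) - vect n (of_int n * \<alpha>) * vect m (of_int m * \<alpha>)
     = lpdo_scale (of_int (n - m)) (vect (m + n) (of_int (m + n) * \<alpha>))"
proof -
  let ?a = "of_int m * \<alpha>" and ?b = "of_int n * \<alpha>"
  let ?X = "t_pow (m + n) * del" and ?Y = "t_pow (m + n)"
  have "vect m ?a * vect n ?b - vect n ?b * vect m ?a
      = (lpdo_scale (of_int n + ?a + ?b) ?X - lpdo_scale (of_int m + ?b + ?a) ?X)
        + (lpdo_scale ((of_int n + ?a) * ?b) ?Y - lpdo_scale ((of_int m + ?b) * ?a) ?Y)"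
    by (simp only: vect_mult_vect add.commute[of n m]) simp
  also have "\<dots> = lpdo_scale (of_int (n - m)) ?X
      + lpdo_scale (of_int (n - m) * (of_int (m + n) * \<alpha>)) ?Y"
    by (simp only: lpdo.scale_left_diff_distrib[symmetric]) (simp add: algebra_simps)
  finally show ?thesis
    by (simp add: vect_def lpdo.scale_right_distrib)
qed

lemma vect_t_pow_commutator:
  "vect m a * t_pow n - t_pow n * vect m a = lpdo_scale (of_int n) (t_pow (m + n))"
  by (simp add: vect_mult_t_pow t_pow_mult_vect add.commute[of n m])
    (simp add: vect_def lpdo.scale_left_distrib)

fun basis_to_lpdo :: "complex \<Rightarrow> complex \<Rightarrow> hv_basis \<Rightarrow> lpdo" where
  "basis_to_lpdo \<alpha> \<beta> (BL m) = vect m (of_int m * \<alpha>)"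
| "basis_to_lpdo \<alpha> \<beta> (BI m) = lpdo_scale \<beta> (t_pow m)"
| "basis_to_lpdo \<alpha> \<beta> _ = 0"

definition hv_to_lpdo :: "complex \<Rightarrow> complex \<Rightarrow> hv \<Rightarrow> lpdo"
  where "hv_to_lpdo \<alpha> \<beta> x =
    (\<Sum>a\<in>Poly_Mapping.keys x. lpdo_scale (Poly_Mapping.lookup x a) (basis_to_lpdo \<alpha> \<beta> a))"

lemma hv_to_lpdo_add: "hv_to_lpdo \<alpha> \<beta> (x + y) = hv_to_lpdo \<alpha> \<beta> x + hv_to_lpdo \<alpha> \<beta> y"
  unfolding hv_to_lpdo_def
  by (rule setsum_keys_plus_distrib) (simp_all add: lpdo.scale_left_distrib)

lemma hv_to_lpdo_scale: "hv_to_lpdo \<alpha> \<beta> (hv_scale c x) = lpdo_scale c (hv_to_lpdo \<alpha> \<beta> x)"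
  by (cases "c = 0")
    (simp_all add: hv_to_lpdo_def hv_keys_scale lpdo.scale_sum_right)

lemma hv_to_lpdo_zero: "hv_to_lpdo \<alpha> \<beta> 0 = 0"
  by (simp add: hv_to_lpdo_def)

lemma hv_to_lpdo_uminus: "hv_to_lpdo \<alpha> \<beta> (- x) = - hv_to_lpdo \<alpha> \<beta> x"
  using hv_to_lpdo_scale[of \<alpha> \<beta> "-1" x] by simp

lemma hv_to_lpdo_single: "hv_to_lpdo \<alpha> \<beta> (Poly_Mapping.single a 1) = basis_to_lpdo \<alpha> \<beta> a"
  by (simp add: hv_to_lpdo_def)

lemma hv_to_lpdo_generators:
  "hv_to_lpdo \<alpha> \<beta> (hvL m) = vect m (of_int m * \<alpha>)"
  "hv_to_lpdo \<alpha> \<beta> (hvI m) = lpdo_scale \<beta> (t_pow m)"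
  "hv_to_lpdo \<alpha> \<beta> hvC1 = 0" "hv_to_lpdo \<alpha> \<beta> hvC2 = 0" "hv_to_lpdo \<alpha> \<beta> hvC3 = 0"
  by (simp_all add: hvL_def hvI_def hvC1_def hvC2_def hvC3_def hv_to_lpdo_single)

text \<open>The central terms of the brackets are sent to \<open>0\<close>, so only the commutators of
  \<open>t\<^sup>m (\<partial> + m \<alpha>)\<close> and \<open>\<beta> t\<^sup>n\<close> have to be compared with the remaining structure constants.\<close>

lemma hv_to_lpdo_bracket_basis:
  "hv_to_lpdo \<alpha> \<beta> (bracket_basis a b)
     = basis_to_lpdo \<alpha> \<beta> a * basis_to_lpdo \<alpha> \<beta> b - basis_to_lpdo \<alpha> \<beta> b * basis_to_lpdo \<alpha> \<beta> a"
proof -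
  have no_cocycle: "hv_to_lpdo \<alpha> \<beta> (if P then hv_scale c C else 0) = 0"
    if "hv_to_lpdo \<alpha> \<beta> C = 0" for P c C
    using that by (simp add: hv_to_lpdo_scale hv_to_lpdo_zero)
  note eval_bracket = bracket_basis.simps hv_to_lpdo_add hv_to_lpdo_uminus hv_to_lpdo_scale
    hv_to_lpdo_generators no_cocycle add_0_right
  have LL: "hv_to_lpdo \<alpha> \<beta> (bracket_basis (BL m) (BL n))
      = vect m (of_int m * \<alpha>) * vect n (of_int n * \<alpha>)
        - vect n (of_int n * \<alpha>) * vect m (of_int m * \<alpha>)" for m n
    by (simp only: eval_bracket vect_commutator)
  have LI: "hv_to_lpdo \<alpha> \<beta> (bracket_basis (BL m) (BI n))
      = vect m (of_int m * \<alpha>) * lpdo_scale \<beta> (t_pow n)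
        - lpdo_scale \<beta> (t_pow n) * vect m (of_int m * \<alpha>)" for m n
  proof -
    have "vect m (of_int m * \<alpha>) * lpdo_scale \<beta> (t_pow n)
          - lpdo_scale \<beta> (t_pow n) * vect m (of_int m * \<alpha>)
        = lpdo_scale \<beta> (lpdo_scale (of_int n) (t_pow (m + n)))"
      by (simp only: lpdo.scale_mult_left lpdo.scale_mult_right
          lpdo.scale_right_diff_distrib[symmetric] vect_t_pow_commutator)
    then show ?thesis
      by (simp only: eval_bracket lpdo.scale_left_commute)
  qed
  have IL: "bracket_basis (BI n) (BL m) = - bracket_basis (BL m) (BI n)" for m n
    by (rule bracket_basis_swap)
  have II: "hv_to_lpdo \<alpha> \<beta> (bracket_basis (BI m) (BI n)) = 0" for m n
    by (simp only: eval_bracket)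
  have comm: "t_pow m * t_pow n = t_pow n * t_pow m" for m n
    by (simp only: t_pow_add[symmetric] add.commute)
  show ?thesis
    by (cases a; cases b)
      (simp_all add: LL LI IL II comm hv_to_lpdo_uminus hv_to_lpdo_zero lpdo.scale_mult_left
        lpdo.scale_mult_right del: bracket_basis.simps(1-4))
qed

lemma hv_to_lpdo_bracket:
  "hv_to_lpdo \<alpha> \<beta> (hv_bracket x y)
     = hv_to_lpdo \<alpha> \<beta> x * hv_to_lpdo \<alpha> \<beta> y - hv_to_lpdo \<alpha> \<beta> y * hv_to_lpdo \<alpha> \<beta> x"
proof -
  note linear = hv_bracket_scale_left hv_bracket_scale_right hv_bracket_add_left
    hv_bracket_add_right hv_to_lpdo_add hv_to_lpdo_scale lpdo.scale_mult_left
    lpdo.scale_mult_right lpdo.scale_right_diff_distrib distrib_left distrib_right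
  show ?thesis
  proof (induction x rule: hv_induct)
    case (basis a)
    show ?case
      by (induction y rule: hv_induct)
        (simp_all add: hv_bracket_single hv_to_lpdo_single hv_to_lpdo_bracket_basis linear)
  qed (simp_all add: linear)
qed

lemma hv_lie_module_eqI:
  assumes "lie_module hv_scale hv_bracket scale \<rho>" "lie_module hv_scale hv_bracket scale \<sigma>"
    and eq: "\<And>a. \<rho> (Poly_Mapping.single a 1) = \<sigma> (Poly_Mapping.single a 1)"
  shows "\<rho> = \<sigma>"
proof
  interpret R: lie_module hv_scale hv_bracket scale \<rho> by fact
  interpret S: lie_module hv_scale hv_bracket scale \<sigma> by fact
  show "\<rho> x = \<sigma> x" for x
    by (induction x rule: hv_induct)
      (simp_all add: eq fun_eq_iff R.act_add_left R.act_scale_left S.act_add_left S.act_scale_left)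
qed

theorem proposition3p1:
  fixes scale :: "complex \<Rightarrow> 'v::ab_group_add \<Rightarrow> 'v"
    and act :: "lpdo \<Rightarrow> 'v \<Rightarrow> 'v"
    and \<alpha> \<beta> :: complex
  assumes "irreducible_assoc_module lpdo_scale scale act"
  shows "\<exists>!\<rho> :: hv \<Rightarrow> 'v \<Rightarrow> 'v.
    lie_module hv_scale hv_bracket scale \<rho> \<and>
    (\<forall>m v. \<rho> (hvL m) v = act (t_pow m * del + lpdo_scale (of_int m * \<alpha>) (t_pow m)) v) \<and>
    (\<forall>m v. \<rho> (hvI m) v = act (lpdo_scale \<beta> (t_pow m)) v) \<and>
    (\<forall>v. \<rho> hvC1 v = 0) \<and> (\<forall>v. \<rho> hvC2 v = 0) \<and> (\<forall>v. \<rho> hvC3 v = 0)"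
    (is "\<exists>!\<rho>. ?P \<rho>")
proof -
  interpret irreducible_assoc_module lpdo_scale scale act by fact
  have act_zero: "act 0 v = 0" for v
    using act_add_left[of 0 0 v] by simp
  have module: "lie_module hv_scale hv_bracket scale (\<lambda>x. act (hv_to_lpdo \<alpha> \<beta> x))"
    by (rule lie_module_pullback[OF hv.lie_algebra_axioms])
      (rule hv_to_lpdo_add hv_to_lpdo_scale hv_to_lpdo_bracket)+
  show ?thesis
  proof (rule ex1I)
    show "?P (\<lambda>x. act (hv_to_lpdo \<alpha> \<beta> x))"
      using module by (simp add: hv_to_lpdo_generators act_zero vect_def)
  next
    fix \<rho> assume \<rho>: "?P \<rho>"
    have "\<rho> (Poly_Mapping.single a 1) = act (hv_to_lpdo \<alpha> \<beta> (Poly_Mapping.single a 1))" for a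
      using \<rho> by (cases a)
        (simp_all add: fun_eq_iff hv_to_lpdo_generators act_zero vect_def
          flip: hvL_def hvI_def hvC1_def hvC2_def hvC3_def)
    then show "\<rho> = (\<lambda>x. act (hv_to_lpdo \<alpha> \<beta> x))"
      using \<rho> module by (intro hv_lie_module_eqI) simp_all
  qed
qed

end
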